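(* Let $Y$ be a finite dimensional Euclidean space, $K\subseteq Y$ a closed convex cone, $A:\mathbb{R}^m\to Y$ an injective linear map, $b\in Y$, $c\in\mathbb{R}^m$, and consider the conic linear systems $$(P)\quad Ax\le_K b,\qquad\qquad (D)\quad A^*y=c,\ y\in K^*.$$ Then the following hold. (1) $(D)$ is infeasible if and only if it has a reformulation $$\langle a_i',y\rangle=0\ (i=1,\dots,k),\quad \langle a_{k+1}',y\rangle=-1,\quad \langle a_i',y\rangle=c_i'\ (i=k+2,\dots,m),\quad y\in K^*,$$ where $(a_1',\dots,a_{k+1}')\in\mathrm{FR}_{k+1}(K^* )$ and $0\le k\le\ell_{K^*}-1$. (2) $(D)$ is not strongly infeasible if and only if there is $(y_1,\dots,y_{\ell+1})\in\mathrm{FR}_{\ell+1}(K)$ such that $0\le\ell\le\ell_K-1$, $A^*y_i=0$ $(i=1,\dots,\ell)$ and $A^*y_{\ell+1}=c$. (3) $(P)$ is infeasible if and only if there is $(y_1,\dots,y_{k+1})\in\mathrm{FR}_{k+1}(K)$ such that $0\le k\le\ell_K-1$ and $$A^*y_i=0,\ \langle b,y_i\rangle=0\ (i=1,\dots,k),\qquad A^*y_{k+1}=0,\ \langle b,y_{k+1}\rangle=-1.$$ (4) $(P)$ is not strongly infeasible if and only if it has a reformulation $$\sum_{i=1}^m x_ia_i'\le_K b',$$ where $(a_1',\dots,a_\ell',b')\in\mathrm{FR}_{\ell+1}(K^* )$ and $0\le\ell\le\min\{m,\ell_{K^*}-1\}$. In all parts the facial reduction sequences can be chosen to be pre-strict.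 (The integers $k$, $\ell$ and the reformulations in the different parts may be different.)
   Context: Notation: $s\le_K t$ means $t-s\in K$; $K^*=\{y\in Y:\langle y,x\rangle\ge0\ \forall x\in K\}$; $A^*$ is the adjoint of $A$; $S^\perp$ is the orthogonal complement of the linear span of $S$. Write $Ax=\sum_{i=1}^m x_ia_i$, so $A^*y=(\langle a_1,y\rangle,\dots,\langle a_m,y\rangle)^T$. Strong infeasibility: $(P)$ is strongly infeasible if $A^*y=0,\ \langle b,y\rangle=-1,\ y\in K^*$ has a solution $y$; $(D)$ is strongly infeasible if $Ax\in K,\ \langle c,x\rangle=-1$ has a solution $x$. Reformulation: since $K$ is a general closed convex cone, here it means the result of a finite sequence of elementary row operations on the data $(A,b,c)$: replace $(a_i,c_i)$ by $(A\lambda,\langle c,\lambda\rangle)$ for some $i$ and $\lambda\in\mathbb{R}^m$ with $\lambda_i\ne0$; switch $(a_i,c_i)$ with $(a_j,c_j)$, $i\ne j$; replace $b$ by $b+A\mu$ with $\mu\in\mathbb{R}^m$. For a closed convex cone $C$ and $k\ge1$, $\mathrm{FR}_k(C)=\{(y_1,\dots,y_k): y_1\in C^*,\ y_i\in(C\cap y_1^\perp\cap\dots\cap y_{i-1}^\perp)^*,\ i=2,\dots,k\}$. An element is strict if for $i=1,\dots,k$, $y_i\in C_i^*\setminus C_i^\perp$ with $C_i=C\cap y_1^\perp\cap\dots\cap y_{i-1}^\perp$ ($C_1=C$); it is pre-strict if $(y_1,\dots,y_{k-1})$ is strict (vacuous if $k=1$). A convex subset $F$ of $C$ is a face of $C$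 if $y,z\in C$, $\frac12(y+z)\in F$ imply $y,z\in F$. $\ell_C$ is the largest $k$ such that there are nonempty faces $F_1\subsetneq\dots\subsetneq F_k$ of $C$. *)

theory Defs
  imports "HOL-Analysis.Analysis"
begin

text \<open>
  Coordinates are numbered \<open>1, \<dots>, m\<close> because row operations and facial reduction sequences
  refer to initial segments of the rows. A vector of $R^m$ is a function on \<open>nat\<close> vanishing
  outside \<open>{1..m}\<close>, and a linear map from $R^m$ is given by the images \<open>a 1, \<dots>, a m\<close> of the
  unit vectors; the case \<open>m = 0\<close> is included.
\<close>

definition Rvec :: "nat \<Rightarrow> (nat \<Rightarrow> real) set" where
  "Rvec m = {x. \<forall>i. i \<notin> {1..m} \<longrightarrow> x i = 0}"

definition Rinner :: "nat \<Rightarrow> (nat \<Rightarrow> real) \<Rightarrow> (nat \<Rightarrow> real) \<Rightarrow> real" where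
  "Rinner m c x = (\<Sum>i=1..m. c i * x i)"

definition lin_map :: "nat \<Rightarrow> (nat \<Rightarrow> 'a) \<Rightarrow> (nat \<Rightarrow> real) \<Rightarrow> 'a::euclidean_space" where
  "lin_map m a x = (\<Sum>i=1..m. x i *\<^sub>R a i)"

definition adj :: "nat \<Rightarrow> (nat \<Rightarrow> 'a) \<Rightarrow> 'a::euclidean_space \<Rightarrow> (nat \<Rightarrow> real)" where
  "adj m a y = (\<lambda>i. if i \<in> {1..m} then a i \<bullet> y else 0)"

lemma Rinner_adj: "Rinner m (adj m a y) x = lin_map m a x \<bullet> y"
  by (simp add: Rinner_def adj_def lin_map_def inner_sum_left mult.commute)


definition cone_le :: "'a::euclidean_space set \<Rightarrow> 'a \<Rightarrow> 'a \<Rightarrow> bool" where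
  "cone_le K s t \<longleftrightarrow> t - s \<in> K"

definition dual_cone :: "'a::euclidean_space set \<Rightarrow> 'a set" where
  "dual_cone K = {y. \<forall>x\<in>K. 0 \<le> y \<bullet> x}"

definition perp :: "'a::euclidean_space set \<Rightarrow> 'a set" where
  "perp S = (span S)\<^sup>\<bottom>"

definition P_feasible :: "nat \<Rightarrow> 'a::euclidean_space set \<Rightarrow> (nat \<Rightarrow> 'a) \<Rightarrow> 'a \<Rightarrow> bool" where
  "P_feasible m K a b \<longleftrightarrow> (\<exists>x\<in>Rvec m. cone_le K (lin_map m a x) b)"

definition D_feasible ::
    "nat \<Rightarrow> 'a::euclidean_space set \<Rightarrow> (nat \<Rightarrow> 'a) \<Rightarrow> (nat \<Rightarrow> real) \<Rightarrow> bool" where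
  "D_feasible m K a c \<longleftrightarrow> (\<exists>y\<in>dual_cone K. adj m a y = c)"

definition P_strongly_infeasible ::
    "nat \<Rightarrow> 'a::euclidean_space set \<Rightarrow> (nat \<Rightarrow> 'a) \<Rightarrow> 'a \<Rightarrow> bool" where
  "P_strongly_infeasible m K a b \<longleftrightarrow>
     (\<exists>y. adj m a y = (\<lambda>_. 0) \<and> b \<bullet> y = -1 \<and> y \<in> dual_cone K)"

definition D_strongly_infeasible ::
    "nat \<Rightarrow> 'a::euclidean_space set \<Rightarrow> (nat \<Rightarrow> 'a) \<Rightarrow> (nat \<Rightarrow> real) \<Rightarrow> bool" where
  "D_strongly_infeasible m K a c \<longleftrightarrow>
     (\<exists>x\<in>Rvec m. lin_map m a x \<in> K \<and> Rinner m c x = -1)"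


inductive row_op ::
    "nat \<Rightarrow> (nat \<Rightarrow> 'a::euclidean_space) \<times> 'a \<times> (nat \<Rightarrow> real)
         \<Rightarrow> (nat \<Rightarrow> 'a) \<times> 'a \<times> (nat \<Rightarrow> real) \<Rightarrow> bool" for m where
  replace_row:
    "i \<in> {1..m} \<Longrightarrow> l \<in> Rvec m \<Longrightarrow> l i \<noteq> 0 \<Longrightarrow>
       row_op m (a, b, c) (a(i := lin_map m a l), b, c(i := Rinner m c l))"
| switch_rows:
    "i \<in> {1..m} \<Longrightarrow> j \<in> {1..m} \<Longrightarrow> i \<noteq> j \<Longrightarrow>
       row_op m (a, b, c) (a(i := a j, j := a i), b, c(i := c j, j := c i))"
| shift_rhs:
    "u \<in> Rvec m \<Longrightarrow> row_op m (a, b, c) (a, b + lin_map m a u, c)"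

abbreviation reformulation ::
    "nat \<Rightarrow> (nat \<Rightarrow> 'a::euclidean_space) \<times> 'a \<times> (nat \<Rightarrow> real)
         \<Rightarrow> (nat \<Rightarrow> 'a) \<times> 'a \<times> (nat \<Rightarrow> real) \<Rightarrow> bool" where
  "reformulation m \<equiv> (row_op m)\<^sup>*\<^sup>*"


text \<open>
  A tuple \<open>(y 1, \<dots>, y k)\<close> is represented by a function on \<open>nat\<close> of which only the values on
  \<open>{1..k}\<close> matter; \<open>fr_cone C y i\<close> is $C_i$.
\<close>

definition fr_cone :: "'a::euclidean_space set \<Rightarrow> (nat \<Rightarrow> 'a) \<Rightarrow> nat \<Rightarrow> 'a set" where
  "fr_cone C y i = C \<inter> (\<Inter>j\<in>{1..<i}. perp {y j})"

definition FR :: "nat \<Rightarrow> 'a::euclidean_space set \<Rightarrow> (nat \<Rightarrow> 'a) set" where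
  "FR k C = {y. \<forall>i\<in>{1..k}. y i \<in> dual_cone (fr_cone C y i)}"

definition strict_FR :: "nat \<Rightarrow> 'a::euclidean_space set \<Rightarrow> (nat \<Rightarrow> 'a) set" where
  "strict_FR k C =
     {y. \<forall>i\<in>{1..k}. y i \<in> dual_cone (fr_cone C y i) - perp (fr_cone C y i)}"

definition pre_strict_FR :: "nat \<Rightarrow> 'a::euclidean_space set \<Rightarrow> (nat \<Rightarrow> 'a) set" where
  "pre_strict_FR k C = FR k C \<inter> strict_FR (k - 1) C"


text \<open>For convex \<open>C\<close>, the library's faces are the convex subsets with the midpoint property.\<close>

lemma face_of_iff_midpoint:
  fixes C :: "'a::euclidean_space set"
  assumes "convex C"
  shows "F face_of C \<longleftrightarrow> F \<subseteq> C \<and> convex F \<and>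
    (\<forall>y\<in>C. \<forall>z\<in>C. (1/2) *\<^sub>R (y + z) \<in> F \<longrightarrow> y \<in> F \<and> z \<in> F)" (is "?L \<longleftrightarrow> ?R")
proof
  assume L: ?L
  have "y \<in> F \<and> z \<in> F" if "y \<in> C" "z \<in> C" "(1/2) *\<^sub>R (y + z) \<in> F" for y z
  proof (cases "y = z")
    case True
    with that show ?thesis by (simp flip: scaleR_2)
  next
    case False
    then have "(1/2) *\<^sub>R (y + z) \<in> open_segment y z"
      unfolding in_segment by (intro conjI exI[of _ "1/2"]) (auto simp: algebra_simps)
    with L that show ?thesis unfolding face_of_def by blast
  qed
  with L show ?R by (simp add: face_of_imp_subset face_of_imp_convex)
next
  assume R: ?R
  have mid: "y \<in> F \<and> z \<in> F" if "y \<in> C" "z \<in> C" "w \<in> F" "w = (1/2) *\<^sub>R (y + z)" for w y z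
    using R that by blast
  have half: "a \<in> C \<Longrightarrow> b \<in> C \<Longrightarrow> 1 / 2 ^ n \<le> u \<Longrightarrow> u \<le> 1/2 \<Longrightarrow> a + u *\<^sub>R (b - a) \<in> F \<Longrightarrow>
      a + (1/2) *\<^sub>R (b - a) \<in> F" for a b n u
  proof (induction n arbitrary: u)
    case 0
    then show ?case by simp
  next
    case (Suc n)
    have u: "0 < u" using Suc.prems(3) by (smt (verit) zero_less_divide_1_iff zero_less_power)
    have "(1 - 2 * u) *\<^sub>R a + (2 * u) *\<^sub>R b \<in> C"
      using \<open>convex C\<close> Suc.prems u by (intro convexD) auto
    then have c: "a + (2 * u) *\<^sub>R (b - a) \<in> C" by (simp add: algebra_simps)
    have eq: "a + u *\<^sub>R (b - a) = (1/2) *\<^sub>R (a + (a + (2 * u) *\<^sub>R (b - a)))"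
      by (simp add: algebra_simps flip: scaleR_left_distrib)
    have f: "a + (2 * u) *\<^sub>R (b - a) \<in> F"
      using mid[OF Suc.prems(1) c Suc.prems(5) eq] by simp
    show ?case
    proof (cases "2 * u \<le> 1/2")
      case True
      with Suc.prems f show ?thesis by (intro Suc.IH[of "2 * u"]) (auto simp: field_simps)
    next
      case False
      define s where "s = (1/2 - u) / u"
      have s: "0 \<le> s" "s \<le> 1" "u + s * u = 1/2"
        using False u Suc.prems by (auto simp: s_def field_simps)
      define v where "v = u *\<^sub>R (b - a)"
      have v: "(2 * u) *\<^sub>R (b - a) = v + v"
        unfolding v_def mult_2 by (rule scaleR_left_distrib)
      have "(1 - s) *\<^sub>R (a + v) + s *\<^sub>R (a + (v + v)) \<in> F"
        using R f Suc.prems s unfolding v by (intro convexD) (auto simp: v_def)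
      also have "(1 - s) *\<^sub>R (a + v) + s *\<^sub>R (a + (v + v)) = a + (v + s *\<^sub>R v)"
        by (simp add: scaleR_add_right scaleR_diff_left)
      also have "v + s *\<^sub>R v = (u + s * u) *\<^sub>R (b - a)"
        by (simp add: v_def scaleR_left_distrib)
      finally show ?thesis by (simp add: s)
    qed
  qed
  have half': "a + (1/2) *\<^sub>R (b - a) \<in> F"
    if "a \<in> C" "b \<in> C" "0 < u" "u \<le> 1/2" "a + u *\<^sub>R (b - a) \<in> F" for a b u
  proof -
    obtain n where "(1/2) ^ n < u" using real_arch_pow_inv[of u "1/2"] \<open>0 < u\<close> by auto
    then show ?thesis using half[OF that(1,2), of n u] that by (simp add: power_one_over)
  qed
  have "a \<in> F \<and> b \<in> F"
    if ab: "a \<in> C" "b \<in> C" and x: "x \<in> F" "x \<in> open_segment a b" for a b x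
  proof -
    obtain u where u: "0 < u" "u < 1" "x = (1 - u) *\<^sub>R a + u *\<^sub>R b"
      using x by (auto simp: in_segment)
    show ?thesis
    proof (cases "u \<le> 1/2")
      case True
      have "a + u *\<^sub>R (b - a) \<in> F" using x u by (simp add: algebra_simps)
      then have "a + (1/2) *\<^sub>R (b - a) \<in> F" using half' ab u True by blast
      then show ?thesis
        by (rule mid[OF ab]) (simp add: algebra_simps flip: scaleR_left_distrib)
    next
      case False
      have "b + (1 - u) *\<^sub>R (a - b) \<in> F" using x u by (simp add: algebra_simps)
      then have "b + (1/2) *\<^sub>R (a - b) \<in> F" using half'[of b a "1 - u"] ab u False by simp
      then show ?thesis
        by (rule mid[OF ab]) (simp add: algebra_simps flip: scaleR_left_distrib)
    qed
  qed
  with R show ?L unfolding face_of_def by blast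
qed

text \<open>
  The dimension bounds the length of a chain of faces, so the largest length exists; a convex
  cone is a face of itself, so it is at least 1 and \<open>face_chain_length C - 1\<close> is not truncated.
\<close>

definition face_chain_length :: "'a::euclidean_space set \<Rightarrow> nat" where
  "face_chain_length C = (GREATEST k. \<exists>F :: nat \<Rightarrow> 'a set.
     (\<forall>i\<in>{1..k}. F i face_of C \<and> F i \<noteq> {}) \<and> (\<forall>i\<in>{1..<k}. F i \<subset> F (Suc i)))"

end

theory Submission
  imports Defs
begin

text \<open>
  Let \<open>C\<close> be a convex cone and \<open>L\<close> a subspace. If \<open>L\<close> meets the relative interior of \<open>C\<close>, every
  functional that is nonnegative on \<open>C \<inter> L\<close> agrees on \<open>L\<close> with an element of the dual cone
  (\<open>Farkas_rel_interior\<close>). Otherwise a hyperplane containing \<open>L\<close> supports \<open>C\<close> properly; its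
  normal \<open>y\<close> lies in \<open>L\<^sup>\<bottom>\<close>, and passing from \<open>C\<close> to the proper face \<open>C \<inter> y\<^sup>\<bottom>\<close> loses no
  point of \<open>C \<inter> L\<close>. Such steps cut out a strictly decreasing chain of faces, so there are fewer
  than the length of the longest chain, and then Farkas' lemma applies. The normals, followed by
  the element that Farkas' lemma gives, form a pre-strict facial reduction sequence
  (\<open>facial_reduction_subspace\<close>). Homogenization turns this into a certificate that an affine
  space misses a convex cone (\<open>facial_reduction_affine\<close>).

  The four claims apply these two theorems to the range of \<open>A\<close> together with \<open>K\<close>, and to the
  orthogonal complement of the range together with the dual cone. In the second situation the
  reducing vectors lie in the range of \<open>A\<close>, and strictness makes them linearly independent, so row
  operations can turn them into the first rows (\<open>reformulation_with_rows\<close>). The converses rest on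
  \<open>FR_last_nonneg\<close>: a cone point orthogonal to all terms but the last has a nonnegative inner
  product with the last.
\<close>

section \<open>Orthogonality and separation\<close>

lemma mem_comp_iff: "y \<in> L\<^sup>\<bottom> \<longleftrightarrow> (\<forall>x\<in>L. y \<bullet> x = 0)"
  by (auto simp: orthogonal_comp_def orthogonal_def inner_commute)

lemma mem_comp_span_iff: "y \<in> (span S)\<^sup>\<bottom> \<longleftrightarrow> (\<forall>x\<in>S. y \<bullet> x = 0)"
proof
  assume R: "\<forall>x\<in>S. y \<bullet> x = 0"
  have "span S \<subseteq> {x. y \<bullet> x = 0}"
    by (rule span_minimal) (use R in \<open>auto simp: subspace_hyperplane\<close>)
  then show "y \<in> (span S)\<^sup>\<bottom>" by (auto simp: mem_comp_iff)
qed (auto simp: mem_comp_iff span_base)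

lemma mem_perp_iff: "y \<in> perp S \<longleftrightarrow> (\<forall>x\<in>S. y \<bullet> x = 0)"
  by (simp add: perp_def mem_comp_span_iff)

lemma mem_dual_cone_iff: "y \<in> dual_cone C \<longleftrightarrow> (\<forall>x\<in>C. 0 \<le> y \<bullet> x)"
  by (simp add: dual_cone_def)

lemma convex_cone_dual_cone: "convex_cone (dual_cone C)"
  unfolding convex_cone_iff by (simp add: mem_dual_cone_iff inner_add_left)

lemma orthogonal_separation:
  fixes L :: "'a::euclidean_space set"
  assumes L: "subspace L" and b: "b \<notin> L"
  obtains u where "u \<in> L\<^sup>\<bottom>" "b \<bullet> u = -1"
proof -
  have "b \<notin> L\<^sup>\<bottom>\<^sup>\<bottom>" using b orthogonal_comp_self[OF L] by simp
  then obtain v where v: "v \<in> L\<^sup>\<bottom>" "b \<bullet> v \<noteq> 0" by (auto simp: mem_comp_iff)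
  then have "(- 1 / (b \<bullet> v)) *\<^sub>R v \<in> L\<^sup>\<bottom>"
    by (intro subspace_scale subspace_orthogonal_comp)
  with v that show thesis by fastforce
qed

text \<open>This is \<open>(L \<inter> M)\<^sup>\<bottom> = L\<^sup>\<bottom> + M\<^sup>\<bottom>\<close>, read as an extension property.\<close>

lemma orthogonal_to_Int_decompose:
  fixes L M :: "'a::euclidean_space set"
  assumes "subspace L" "subspace M" and z: "\<And>x. x \<in> L \<Longrightarrow> x \<in> M \<Longrightarrow> z \<bullet> x = 0"
  obtains y where "y \<in> M\<^sup>\<bottom>" "y - z \<in> L\<^sup>\<bottom>"
proof -
  let ?S = "L\<^sup>\<bottom> + M\<^sup>\<bottom>"
  have sub: "subspace (L\<^sup>\<bottom>)" "subspace (M\<^sup>\<bottom>)"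
    by (simp_all add: subspace_orthogonal_comp)
  have S: "subspace ?S"
  proof -
    have "?S = {x + y |x y. x \<in> L\<^sup>\<bottom> \<and> y \<in> M\<^sup>\<bottom>}" by (auto simp: set_plus_def)
    then show ?thesis using subspace_sums[OF sub] by simp
  qed
  have "?S\<^sup>\<bottom> \<subseteq> L"
    using orthogonal_comp_anti_mono[of "L\<^sup>\<bottom>" ?S] orthogonal_comp_self[OF assms(1)]
      set_zero_plus2[of "M\<^sup>\<bottom>" "L\<^sup>\<bottom>"] subspace_0[OF sub(2)] by (simp add: add.commute)
  moreover have "?S\<^sup>\<bottom> \<subseteq> M"
    using orthogonal_comp_anti_mono[of "M\<^sup>\<bottom>" ?S] orthogonal_comp_self[OF assms(2)]
      set_zero_plus2[of "L\<^sup>\<bottom>" "M\<^sup>\<bottom>"] subspace_0[OF sub(1)] by simp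
  ultimately have "z \<in> ?S\<^sup>\<bottom>\<^sup>\<bottom>" using z unfolding mem_comp_iff[of z] by blast
  then have "z \<in> ?S" using orthogonal_comp_self[OF S] by simp
  then obtain w y where wy: "w \<in> L\<^sup>\<bottom>" "y \<in> M\<^sup>\<bottom>" "z = w + y" by (auto elim: set_plus_elim)
  then have "y - z \<in> L\<^sup>\<bottom>" using subspace_neg[OF sub(1)] by simp
  with wy that show thesis by blast
qed

text \<open>
  The relative interior of \<open>C + L\<close> is \<open>rel_interior C + L\<close>, which omits \<open>0\<close>; a hyperplane
  supporting \<open>C + L\<close> at \<open>0\<close> is the required one, being nonnegative on a subspace only if it
  vanishes there.
\<close>

lemma separate_cone_subspace:
  fixes C L :: "'a::euclidean_space set"
  assumes C: "convex_cone C" and L: "subspace L" and disj: "rel_interior C \<inter> L = {}"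
  obtains w where "w \<in> dual_cone C" "w \<in> L\<^sup>\<bottom>" "\<forall>x\<in>rel_interior C. 0 < w \<bullet> x"
proof -
  have cC: "convex C" "0 \<in> C" and cL: "convex L" "0 \<in> L"
    using C L by (auto simp: convex_cone_def convex_cone_contains_0 subspace_imp_convex subspace_0)
  have riL: "rel_interior L = L" by (simp add: L rel_interior_affine subspace_imp_affine)
  have ri: "rel_interior (C + L) = rel_interior C + L"
    by (simp add: rel_interior_sum cC cL riL)
  have "0 \<notin> rel_interior C + L"
  proof
    assume "0 \<in> rel_interior C + L"
    then obtain x l where "x \<in> rel_interior C" "l \<in> L" "0 = x + l" by (auto elim: set_plus_elim)
    then have "x = - l" by (simp add: eq_neg_iff_add_eq_0)
    with \<open>x \<in> _\<close> \<open>l \<in> L\<close> disj subspace_neg[OF L] show False by blast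
  qed
  moreover have "0 \<in> C + L" using set_plus_intro[OF cC(2) cL(2)] by simp
  ultimately obtain w where
    w: "\<And>x. x \<in> C + L \<Longrightarrow> w \<bullet> 0 \<le> w \<bullet> x" "\<And>x. x \<in> rel_interior (C + L) \<Longrightarrow> w \<bullet> 0 < w \<bullet> x"
    using supporting_hyperplane_rel_boundary[of "C + L" 0] ri convex_set_plus[OF cC(1) cL(1)]
    by metis
  have "0 \<le> w \<bullet> x" if "x \<in> C" for x using w(1)[OF set_plus_intro[OF that cL(2)]] by simp
  moreover have "0 \<le> w \<bullet> x" if "x \<in> L" for x using w(1)[OF set_plus_intro[OF cC(2) that]] by simp
  then have "w \<bullet> x = 0" if "x \<in> L" for x
    using that subspace_neg[OF L that] by (metis inner_minus_right neg_0_le_iff_le order_antisym)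
  moreover have "0 < w \<bullet> x" if "x \<in> rel_interior C" for x
    using w(2) set_plus_intro[OF that cL(2)] by (simp add: ri)
  ultimately show thesis by (intro that) (auto simp: mem_dual_cone_iff mem_comp_iff)
qed

text \<open>
  For a closed cone \<open>C\<close>, such a \<open>z\<close> lies in the closure of \<open>dual_cone C + L\<^sup>\<bottom>\<close>, which can be
  larger than the sum itself. A common point of \<open>L\<close> and the relative interior brings \<open>z\<close> into the
  sum.
  If the hyperplane where \<open>z\<close> vanishes misses that relative interior within \<open>L\<close>, a separating
  functional is a positive multiple of \<open>z\<close> on \<open>L\<close>. Otherwise \<open>z\<close> attains its minimum \<open>0\<close> over \<open>C \<inter> L\<close> at a
  relative interior point, hence vanishes on \<open>L \<inter> span C\<close>, and agrees on \<open>L\<close> with a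
  functional that vanishes on \<open>C\<close>.
\<close>

lemma Farkas_rel_interior:
  fixes C L :: "'a::euclidean_space set"
  assumes C: "convex_cone C" and L: "subspace L"
    and p: "p \<in> rel_interior C" "p \<in> L"
    and z: "\<And>x. x \<in> C \<Longrightarrow> x \<in> L \<Longrightarrow> 0 \<le> z \<bullet> x"
  obtains y where "y \<in> dual_cone C" "y - z \<in> L\<^sup>\<bottom>"
proof (cases "rel_interior C \<inter> (L \<inter> {x. z \<bullet> x = 0}) = {}")
  case True
  have "subspace (L \<inter> {x. z \<bullet> x = 0})" using L by (simp add: subspace_inter subspace_hyperplane)
  from separate_cone_subspace[OF C this True] obtain w where
    w: "w \<in> dual_cone C" "w \<in> (L \<inter> {x. z \<bullet> x = 0})\<^sup>\<bottom>" "\<forall>x\<in>rel_interior C. 0 < w \<bullet> x" .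
  have "p \<in> C" using p rel_interior_subset by blast
  then have zp: "0 < z \<bullet> p" using z[of p] p True by fastforce
  have wp: "0 < w \<bullet> p" using w p by blast
  define y where "y = (z \<bullet> p / (w \<bullet> p)) *\<^sub>R w"
  have "y \<bullet> x = z \<bullet> x" if "x \<in> L" for x
  proof -
    have "x - (z \<bullet> x / (z \<bullet> p)) *\<^sub>R p \<in> L \<inter> {x. z \<bullet> x = 0}"
      using that p L zp by (auto simp: subspace_diff subspace_scale inner_diff_right)
    then have "w \<bullet> (x - (z \<bullet> x / (z \<bullet> p)) *\<^sub>R p) = 0" using w(2) by (simp only: mem_comp_iff)
    then have "w \<bullet> x = z \<bullet> x / (z \<bullet> p) * (w \<bullet> p)" by (simp add: inner_diff_right)
    then show ?thesis using zp wp by (simp add: y_def)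
  qed
  moreover have "y \<in> dual_cone C" using w(1) zp wp by (simp add: y_def mem_dual_cone_iff)
  ultimately show thesis by (intro that) (auto simp: mem_comp_iff inner_diff_left)
next
  case False
  then obtain q where q: "q \<in> rel_interior C" "q \<in> L" "z \<bullet> q = 0" by auto
  have cC: "convex C" "0 \<in> C" using C by (auto simp: convex_cone_def convex_cone_contains_0)
  then have aff: "affine hull C = span C" by (simp add: affine_hull_span_0 hull_inc)
  have le: "z \<bullet> x \<le> 0" if x: "x \<in> L" "x \<in> span C" for x
  proof -
    obtain e where e: "1 < e" "(1 - e) *\<^sub>R x + e *\<^sub>R q \<in> C"
      using bspec[OF convex_rel_interior_if2[OF cC(1) q(1)], of x] x(2) unfolding aff by metis
    have "0 \<le> z \<bullet> ((1 - e) *\<^sub>R x + e *\<^sub>R q)"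
      by (rule z[OF e(2)]) (use that q L in \<open>simp add: subspace_add subspace_scale\<close>)
    then have "0 \<le> (1 - e) * (z \<bullet> x)" using q by (simp add: inner_add_right)
    then show ?thesis using e(1) by (simp add: zero_le_mult_iff)
  qed
  have "z \<bullet> x = 0" if "x \<in> L" "x \<in> span C" for x
    using le[OF that] le[of "-x"] that L by (simp add: subspace_neg span_neg)
  from orthogonal_to_Int_decompose[OF L subspace_span this]
  obtain y where y: "y \<in> (span C)\<^sup>\<bottom>" "y - z \<in> L\<^sup>\<bottom>" .
  then show thesis by (intro that) (auto simp: mem_dual_cone_iff mem_comp_span_iff)
qed

section \<open>Facial reduction sequences\<close>

lemma mem_fr_cone_iff: "x \<in> fr_cone C y i \<longleftrightarrow> x \<in> C \<and> (\<forall>j\<in>{1..<i}. x \<bullet> y j = 0)"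
  by (auto simp: fr_cone_def mem_perp_iff)

lemma fr_cone_1 [simp]: "fr_cone C y (Suc 0) = C"
  by (auto simp: mem_fr_cone_iff)

lemma fr_cone_Suc: "1 \<le> i \<Longrightarrow> fr_cone C y (Suc i) = fr_cone C y i \<inter> {x. y i \<bullet> x = 0}"
  by (auto simp: mem_fr_cone_iff less_Suc_eq inner_commute)

lemma fr_cone_cong: "(\<And>j. 1 \<le> j \<Longrightarrow> j < i \<Longrightarrow> y j = y' j) \<Longrightarrow> fr_cone C y i = fr_cone C y' i"
  by (auto simp: mem_fr_cone_iff)

lemma convex_cone_fr_cone: "convex_cone C \<Longrightarrow> convex_cone (fr_cone C y i)"
  by (auto simp: convex_cone_iff mem_fr_cone_iff inner_add_left)

lemma FR_cong: "(\<And>i. i \<in> {1..k} \<Longrightarrow> y i = y' i) \<Longrightarrow> y \<in> FR k C \<longleftrightarrow> y' \<in> FR k C"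
  using fr_cone_cong[of _ y y' C] by (auto simp: FR_def)

lemma strict_FR_cong:
  "(\<And>i. i \<in> {1..k} \<Longrightarrow> y i = y' i) \<Longrightarrow> y \<in> strict_FR k C \<longleftrightarrow> y' \<in> strict_FR k C"
  using fr_cone_cong[of _ y y' C] by (auto simp: strict_FR_def)

lemma pre_strict_FR_cong:
  "(\<And>i. i \<in> {1..k} \<Longrightarrow> y i = y' i) \<Longrightarrow> y \<in> pre_strict_FR k C \<longleftrightarrow> y' \<in> pre_strict_FR k C"
  unfolding pre_strict_FR_def Int_iff
  by (intro arg_cong2[where f = "(\<and>)"] FR_cong strict_FR_cong) auto

lemma strict_FR_Suc:
  assumes "y \<in> strict_FR k C" "w \<in> dual_cone (fr_cone C y (k + 1)) - perp (fr_cone C y (k + 1))"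
  shows "y(k + 1 := w) \<in> strict_FR (k + 1) C"
proof -
  have "fr_cone C (y(k + 1 := w)) i = fr_cone C y i" if "i \<le> k + 1" for i
    by (rule fr_cone_cong) (use that in auto)
  with assms show ?thesis by (auto simp: strict_FR_def le_Suc_eq)
qed

lemma pre_strict_FR_Suc:
  assumes "y \<in> strict_FR k C" "w \<in> dual_cone (fr_cone C y (k + 1))"
  shows "y(k + 1 := w) \<in> pre_strict_FR (k + 1) C"
proof -
  have "fr_cone C (y(k + 1 := w)) i = fr_cone C y i" if "i \<le> k + 1" for i
    by (rule fr_cone_cong) (use that in auto)
  with assms show ?thesis by (auto simp: pre_strict_FR_def strict_FR_def FR_def le_Suc_eq)
qed

text \<open>
  The soundness of facial reduction: a point of \<open>C\<close> orthogonal to the first \<open>k\<close> terms stays in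
  every cone of the sequence.
\<close>

lemma FR_last_nonneg:
  assumes "y \<in> FR (k + 1) C" "x \<in> C" "\<And>i. i \<in> {1..k} \<Longrightarrow> x \<bullet> y i = 0"
  shows "0 \<le> y (k + 1) \<bullet> x"
proof -
  have "x \<in> fr_cone C y (k + 1)" using assms by (auto simp: mem_fr_cone_iff)
  then show ?thesis using assms(1) by (auto simp: FR_def mem_dual_cone_iff)
qed

text \<open>
  A vector in the span of the earlier terms vanishes on \<open>fr_cone C y i\<close>, which strictness excludes
  for \<open>y i\<close>. In this form the independence of the terms feeds the construction of
  reformulations one row at a time.
\<close>

lemma strict_FR_not_in_span:
  assumes "y \<in> strict_FR k C" "i \<in> {1..k}"
  shows "y i \<notin> span (y ` {1..<i})"
proof
  assume span: "y i \<in> span (y ` {1..<i})"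
  have "x \<bullet> y i = 0" if "x \<in> fr_cone C y i" for x
  proof -
    have "x \<in> (span (y ` {1..<i}))\<^sup>\<bottom>" using that by (auto simp: mem_comp_span_iff mem_fr_cone_iff)
    then show ?thesis using span by (simp add: mem_comp_iff)
  qed
  then have "y i \<in> perp (fr_cone C y i)" by (simp add: mem_perp_iff inner_commute)
  with assms show False by (auto simp: strict_FR_def)
qed

text \<open>The dimension strictly increases along a chain of faces, so the greatest length exists.\<close>

lemma face_chain_length_ge:
  fixes C :: "'a::euclidean_space set"
  assumes "\<And>i. i \<in> {1..k} \<Longrightarrow> F i face_of C \<and> F i \<noteq> {}" "\<And>i. i \<in> {1..<k} \<Longrightarrow> F i \<subset> F (Suc i)"
  shows "k \<le> face_chain_length C"
proof -
  have bound: "n \<le> DIM('a) + 1"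
    if F: "\<forall>i\<in>{1..n}. F i face_of C \<and> F i \<noteq> {}" "\<forall>i\<in>{1..<n}. F i \<subset> F (Suc i)"
    for n and F :: "nat \<Rightarrow> 'a set"
  proof (cases "n = 0")
    case False
    have "i < n \<Longrightarrow> int i \<le> aff_dim (F (Suc i))" for i
    proof (induction i)
      case 0
      have "F (Suc 0) \<noteq> {}" using F(1) 0 by force
      then show ?case using aff_dim_negative_iff[of "F (Suc 0)"] by linarith
    next
      case (Suc i)
      have sub: "F (Suc i) \<subset> F (Suc (Suc i))" using F(2) Suc.prems by simp
      have fc: "F (Suc i) face_of C" "F (Suc (Suc i)) face_of C" using F(1) Suc.prems by auto
      then have "F (Suc i) face_of F (Suc (Suc i))"
        using sub by (meson face_of_subset face_of_imp_subset psubset_imp_subset)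
      then have "aff_dim (F (Suc i)) < aff_dim (F (Suc (Suc i)))"
        using face_of_aff_dim_lt[of "F (Suc (Suc i))" "F (Suc i)"] face_of_imp_convex fc sub by blast
      with Suc show ?case by simp
    qed
    from this[of "n - 1"] False aff_dim_le_DIM[of "F n"] show ?thesis by simp
  qed simp
  define P where "P n \<longleftrightarrow> (\<exists>F :: nat \<Rightarrow> 'a set. (\<forall>i\<in>{1..n}. F i face_of C \<and> F i \<noteq> {}) \<and>
    (\<forall>i\<in>{1..<n}. F i \<subset> F (Suc i)))" for n
  have "P k" unfolding P_def using assms by (intro exI[of _ F]) simp
  moreover have "\<forall>n. P n \<longrightarrow> n \<le> DIM('a) + 1" unfolding P_def
    by (intro allI impI, elim exE conjE, rule bound)
  ultimately have "k \<le> Greatest P" by (intro Greatest_le_nat) auto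
  then show ?thesis unfolding face_chain_length_def P_def .
qed

text \<open>
  Each cone of the sequence is cut out of the one before by a supporting hyperplane, hence a face,
  and by strictness a proper one. The chain is decreasing, so it is read backwards.
\<close>

lemma strict_FR_length:
  fixes C :: "'a::euclidean_space set"
  assumes C: "convex_cone C" and y: "y \<in> strict_FR k C"
  shows "k + 1 \<le> face_chain_length C"
proof -
  have face: "i \<le> k \<Longrightarrow> fr_cone C y (Suc i) face_of C" for i
  proof (induction i)
    case 0
    then show ?case using C by (simp add: face_of_refl convex_cone_def)
  next
    case (Suc i)
    have "convex (fr_cone C y (Suc i))" using convex_cone_fr_cone[OF C] by (simp add: convex_cone_def)
    moreover have "0 \<le> y (Suc i) \<bullet> x" if "x \<in> fr_cone C y (Suc i)" for x
      using y Suc.prems that by (auto simp: strict_FR_def mem_dual_cone_iff)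
    ultimately have "fr_cone C y (Suc (Suc i)) face_of fr_cone C y (Suc i)"
      by (simp add: fr_cone_Suc face_of_Int_supporting_hyperplane_ge)
    with Suc show ?case by (simp add: face_of_trans)
  qed
  have psub: "fr_cone C y (Suc i) \<subset> fr_cone C y i" if i: "i \<in> {1..k}" for i
  proof -
    have "y i \<notin> perp (fr_cone C y i)" using y i by (auto simp: strict_FR_def)
    then obtain x where "x \<in> fr_cone C y i" "y i \<bullet> x \<noteq> 0" by (auto simp: mem_perp_iff)
    with i show ?thesis by (auto simp: fr_cone_Suc)
  qed
  show ?thesis
  proof (rule face_chain_length_ge[where F = "\<lambda>i. fr_cone C y (k + 2 - i)"])
    fix i assume i: "i \<in> {1..k + 1}"
    then have "k + 2 - i = Suc (k + 1 - i)" by auto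
    with i show "fr_cone C y (k + 2 - i) face_of C \<and> fr_cone C y (k + 2 - i) \<noteq> {}"
      using face[of "k + 1 - i"] convex_cone_nonempty[OF convex_cone_fr_cone[OF C]] by auto
  next
    fix i assume i: "i \<in> {1..<k + 1}"
    then have "k + 2 - i = Suc (k + 2 - Suc i)" "k + 2 - Suc i \<in> {1..k}" by auto
    then show "fr_cone C y (k + 2 - i) \<subset> fr_cone C y (k + 2 - Suc i)"
      using psub[of "k + 2 - Suc i"] by simp
  qed
qed

text \<open>
  The central result. A strict sequence in \<open>L\<^sup>\<bottom>\<close> of greatest length leaves a cone whose
  relative interior meets \<open>L\<close>, since otherwise separation would extend it. Its terms lie in
  \<open>L\<^sup>\<bottom>\<close>, so \<open>C \<inter> L\<close> has lost no point, and Farkas' lemma produces the last term.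
\<close>

theorem facial_reduction_subspace:
  fixes C L :: "'a::euclidean_space set"
  assumes C: "convex_cone C" and L: "subspace L"
    and z: "\<And>x. x \<in> C \<Longrightarrow> x \<in> L \<Longrightarrow> 0 \<le> z \<bullet> x"
  obtains k y where "y \<in> pre_strict_FR (k + 1) C" "k \<le> face_chain_length C - 1"
    "\<forall>i\<in>{1..k}. y i \<in> L\<^sup>\<bottom>" "y (k + 1) - z \<in> L\<^sup>\<bottom>"
proof -
  define P where "P k \<longleftrightarrow> (\<exists>y. y \<in> strict_FR k C \<and> (\<forall>i\<in>{1..k}. y i \<in> L\<^sup>\<bottom>))" for k
  have bound: "k + 1 \<le> face_chain_length C" if "P k" for k
    using that strict_FR_length[OF C] by (auto simp: P_def)
  have "P 0" by (simp add: P_def strict_FR_def)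
  moreover have "\<forall>j. P j \<longrightarrow> j \<le> face_chain_length C" by (intro allI impI) (drule bound, simp)
  ultimately obtain k where "P k" and max: "\<And>j. P j \<Longrightarrow> j \<le> k"
    using Nat.ex_has_greatest_nat[of P 0] by metis
  from \<open>P k\<close> obtain y where y: "y \<in> strict_FR k C" "\<forall>i\<in>{1..k}. y i \<in> L\<^sup>\<bottom>"
    unfolding P_def by blast
  define D where "D = fr_cone C y (k + 1)"
  have D: "convex_cone D" unfolding D_def by (rule convex_cone_fr_cone[OF C])
  then have riD: "rel_interior D \<noteq> {}" by (simp add: convex_cone_def rel_interior_eq_empty)
  have "rel_interior D \<inter> L \<noteq> {}"
  proof
    assume "rel_interior D \<inter> L = {}"
    from separate_cone_subspace[OF D L this] obtain w where
      w: "w \<in> dual_cone D" "w \<in> L\<^sup>\<bottom>" "\<forall>x\<in>rel_interior D. 0 < w \<bullet> x" .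
    obtain q where q: "q \<in> rel_interior D" using riD by auto
    then have "q \<in> D" using rel_interior_subset by blast
    with q have "w \<notin> perp D" using w(3) unfolding mem_perp_iff by (metis less_irrefl)
    with w(1) have "y(k + 1 := w) \<in> strict_FR (k + 1) C"
      unfolding D_def by (intro strict_FR_Suc[OF y(1)]) simp
    moreover have "\<forall>i\<in>{1..k + 1}. (y(k + 1 := w)) i \<in> L\<^sup>\<bottom>"
      using y(2) w(2) by (auto simp: le_Suc_eq)
    ultimately have "P (k + 1)" unfolding P_def by (intro exI conjI)
    then show False using max[of "k + 1"] by linarith
  qed
  then obtain p where p: "p \<in> rel_interior D" "p \<in> L" by auto
  have "0 \<le> z \<bullet> x" if "x \<in> D" "x \<in> L" for x
    using z that by (simp add: D_def mem_fr_cone_iff)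
  from Farkas_rel_interior[OF D L p this] obtain w where w: "w \<in> dual_cone D" "w - z \<in> L\<^sup>\<bottom>" .
  define s where "s = y(k + 1 := w)"
  have "s \<in> pre_strict_FR (k + 1) C"
    unfolding s_def using y(1) w(1) unfolding D_def by (rule pre_strict_FR_Suc)
  moreover have "k \<le> face_chain_length C - 1" using bound[OF \<open>P k\<close>] by simp
  moreover have "\<forall>i\<in>{1..k}. s i \<in> L\<^sup>\<bottom>" using y(2) by (simp add: s_def)
  moreover have "s (k + 1) - z \<in> L\<^sup>\<bottom>" using w(2) by (simp add: s_def)
  ultimately show thesis by (rule that[of s k])
qed

text \<open>
  The version for an affine subspace comes by homogenization: on the cone points \<open>t *\<^sub>R b - x\<close>
  with \<open>x \<in> L\<close>, the functional that is \<open>-1\<close> at \<open>b\<close> and \<open>0\<close> on \<open>L\<close> takes the value \<open>-t\<close>, and a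
  point with \<open>t > 0\<close> could be scaled to one with \<open>t = 1\<close>.
\<close>

theorem facial_reduction_affine:
  fixes C L :: "'a::euclidean_space set"
  assumes C: "convex_cone C" and L: "subspace L"
    and infeasible: "\<And>x. x \<in> L \<Longrightarrow> b - x \<notin> C"
  obtains k y where "y \<in> pre_strict_FR (k + 1) C" "k \<le> face_chain_length C - 1"
    "\<forall>i\<in>{1..k}. y i \<in> L\<^sup>\<bottom> \<and> b \<bullet> y i = 0" "y (k + 1) \<in> L\<^sup>\<bottom>" "b \<bullet> y (k + 1) = -1"
proof -
  have "b \<notin> L" using infeasible[of b] convex_cone_contains_0[OF C] by force
  then obtain z where z: "z \<in> L\<^sup>\<bottom>" "b \<bullet> z = -1" using orthogonal_separation[OF L] by blast
  have comp: "y \<in> (span (insert b L))\<^sup>\<bottom> \<longleftrightarrow> y \<in> L\<^sup>\<bottom> \<and> b \<bullet> y = 0" for y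
    unfolding mem_comp_span_iff by (auto simp: mem_comp_iff inner_commute)
  have nonneg: "0 \<le> z \<bullet> x" if x: "x \<in> C" "x \<in> span (insert b L)" for x
  proof (rule ccontr)
    assume neg: "\<not> 0 \<le> z \<bullet> x"
    obtain t where "x - t *\<^sub>R b \<in> span L" using x(2) by (auto simp: span_breakdown_eq)
    then have t: "x - t *\<^sub>R b \<in> L" using L by (simp add: span_eq_iff[THEN iffD2])
    then have "z \<bullet> (x - t *\<^sub>R b) = 0" using z(1) by (simp add: mem_comp_iff)
    then have "z \<bullet> x = - t" using z(2) by (simp add: inner_diff_right inner_commute)
    with neg have "0 < t" by simp
    then have "(1 / t) *\<^sub>R x \<in> C" using x(1) C by (simp add: convex_cone_scaleR)
    also have "(1 / t) *\<^sub>R x = b - (- 1 / t) *\<^sub>R (x - t *\<^sub>R b)"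
      using \<open>0 < t\<close> by (simp add: algebra_simps)
    finally show False using infeasible subspace_scale[OF L t] by blast
  qed
  from facial_reduction_subspace[OF C subspace_span nonneg] obtain k y where
    ky: "y \<in> pre_strict_FR (k + 1) C" "k \<le> face_chain_length C - 1"
      "\<forall>i\<in>{1..k}. y i \<in> (span (insert b L))\<^sup>\<bottom>"
      "y (k + 1) - z \<in> (span (insert b L))\<^sup>\<bottom>" .
  have last: "y (k + 1) - z \<in> L\<^sup>\<bottom>" "b \<bullet> (y (k + 1) - z) = 0"
    using ky(4) unfolding comp by blast+
  show thesis
  proof (rule that[OF ky(1,2)])
    show "\<forall>i\<in>{1..k}. y i \<in> L\<^sup>\<bottom> \<and> b \<bullet> y i = 0" using ky(3) unfolding comp .
    show "y (k + 1) \<in> L\<^sup>\<bottom>"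
      using subspace_add[OF subspace_orthogonal_comp last(1) z(1)] by simp
    show "b \<bullet> y (k + 1) = -1" using last(2) z(2) by (simp add: inner_diff_right)
  qed
qed

section \<open>Row operations\<close>

lemma lin_map_in_span: "lin_map m a x \<in> span (a ` {1..m})"
  unfolding lin_map_def by (intro span_sum span_scale span_base) auto

lemma span_rows_lin_map:
  assumes "v \<in> span (a ` {1..m})"
  obtains x where "x \<in> Rvec m" "lin_map m a x = v"
proof -
  let ?S = "{v. \<exists>x\<in>Rvec m. lin_map m a x = v}"
  have "subspace ?S"
    unfolding subspace_def
  proof (intro conjI allI ballI)
    show "0 \<in> ?S" by (auto simp: lin_map_def Rvec_def intro!: exI[of _ "\<lambda>_. 0"])
  next
    fix u v assume "u \<in> ?S" "v \<in> ?S"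
    then obtain x y where "x \<in> Rvec m" "y \<in> Rvec m" "u = lin_map m a x" "v = lin_map m a y" by auto
    then show "u + v \<in> ?S"
      by (auto simp: lin_map_def Rvec_def sum.distrib scaleR_add_left
          intro!: exI[of _ "\<lambda>i. x i + y i"])
  next
    fix r u assume "u \<in> ?S"
    then obtain x where "x \<in> Rvec m" "u = lin_map m a x" by auto
    then show "r *\<^sub>R u \<in> ?S"
      by (auto simp: lin_map_def Rvec_def scaleR_sum_right intro!: exI[of _ "\<lambda>i. r * x i"])
  qed
  moreover have "a ` {1..m} \<subseteq> ?S"
  proof clarify
    fix i assume i: "i \<in> {1..m}"
    have "lin_map m a (\<lambda>j. if j = i then 1 else 0) = (\<Sum>j=1..m. if j = i then a j else 0)"
      unfolding lin_map_def by (rule sum.cong) auto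
    with i show "\<exists>x\<in>Rvec m. lin_map m a x = a i"
      by (intro bexI[of _ "\<lambda>j. if j = i then 1 else 0"]) (auto simp: Rvec_def)
  qed
  ultimately have "span (a ` {1..m}) \<subseteq> ?S" by (intro span_minimal)
  with assms that show thesis by blast
qed

lemma adj_eq_iff:
  assumes "c \<in> Rvec m"
  shows "adj m a y = c \<longleftrightarrow> (\<forall>i\<in>{1..m}. a i \<bullet> y = c i)"
  using assms by (auto simp: adj_def Rvec_def fun_eq_iff)

lemma adj_eq_0_iff: "adj m a y = (\<lambda>_. 0) \<longleftrightarrow> y \<in> (span (a ` {1..m}))\<^sup>\<bottom>"
  by (subst adj_eq_iff) (auto simp: Rvec_def mem_comp_span_iff inner_commute)

text \<open>
  Injectivity makes the adjoint surjective: \<open>(0, 1)\<close> is not in the span of the pairs \<open>(a i, c i)\<close>,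
  since a combination of the \<open>a i\<close> that vanishes has zero coefficients,
  and a vector orthogonal to these pairs but not to \<open>(0, 1)\<close> gives a solution after scaling.
\<close>

lemma adj_surj:
  fixes a :: "nat \<Rightarrow> 'a::euclidean_space"
  assumes inj: "inj_on (lin_map m a) (Rvec m)" and c: "c \<in> Rvec m"
  obtains z where "adj m a z = c"
proof -
  let ?g = "\<lambda>i. (a i, c i)"
  have "(0, 1) \<notin> span (?g ` {1..m})"
  proof
    assume "(0, 1) \<in> span (?g ` {1..m})"
    then obtain x where x: "x \<in> Rvec m" "lin_map m ?g x = (0, 1)" by (rule span_rows_lin_map)
    have "fst (lin_map m ?g x) = 0" "snd (lin_map m ?g x) = 1" by (simp_all only: x fst_conv snd_conv)
    then have "lin_map m a x = 0" and s: "(\<Sum>i=1..m. x i * c i) = 1"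
      unfolding lin_map_def fst_sum snd_sum by simp_all
    then have "x = (\<lambda>_. 0)"
      using inj_onD[OF inj, of x "\<lambda>_. 0"] x(1) by (auto simp: lin_map_def Rvec_def)
    with s show False by simp
  qed
  then obtain w where w: "w \<in> (span (?g ` {1..m}))\<^sup>\<bottom>" "(0, 1) \<bullet> w = (-1::real)"
    by (rule orthogonal_separation[OF subspace_span])
  obtain z t where zt: "w = (z, t)" by force
  with w have "t = -1" by simp
  with w zt have "a i \<bullet> z = c i" if "i \<in> {1..m}" for i
    using that by (auto simp: mem_comp_span_iff inner_commute)
  with that[of z] adj_eq_iff[OF c, of a z] show thesis by simp
qed

text \<open>
  The last conjunct is stated in one direction for all solutions of the equations, in the dual cone
  or not: this serves both to carry feasibility of \<open>(D)\<close> over to a reformulation and to compute the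
  new \<open>c'\<close> from the new rows and one solution of the original equations.
\<close>

lemma row_op_invariants:
  assumes "row_op m (a, b, c) (a', b', c')"
  shows "span (a' ` {1..m}) = span (a ` {1..m}) \<and> b' - b \<in> span (a ` {1..m}) \<and>
    (\<forall>y. (\<forall>i\<in>{1..m}. a i \<bullet> y = c i) \<longrightarrow> (\<forall>i\<in>{1..m}. a' i \<bullet> y = c' i))"
  using assms
proof (cases rule: row_op.cases)
  case (replace_row i l)
  have mem: "a j \<in> span (a ` {1..m})" if "j \<in> {1..m}" for j using that by (auto intro: span_base)
  have mem': "a' j \<in> span (a' ` {1..m})" if "j \<in> {1..m}" for j using that by (auto intro: span_base)
  have "a' ` {1..m} \<subseteq> span (a ` {1..m})"
    using mem replace_row(1) lin_map_in_span[of m a l] by auto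
  moreover have "a i \<in> span (a' ` {1..m})"
  proof -
    have "a' i = l i *\<^sub>R a i + (\<Sum>j\<in>{1..m} - {i}. l j *\<^sub>R a j)"
      using replace_row by (simp add: lin_map_def sum.remove[of _ i])
    also have "(\<Sum>j\<in>{1..m} - {i}. l j *\<^sub>R a j) = (\<Sum>j\<in>{1..m} - {i}. l j *\<^sub>R a' j)"
      using replace_row by (intro sum.cong) auto
    finally have "a i = (1 / l i) *\<^sub>R (a' i - (\<Sum>j\<in>{1..m} - {i}. l j *\<^sub>R a' j))"
      using replace_row by simp
    also have "\<dots> \<in> span (a' ` {1..m})"
      using replace_row(4) by (intro span_scale span_diff span_sum mem') auto
    finally show ?thesis .
  qed
  then have "a ` {1..m} \<subseteq> span (a' ` {1..m})"
    using mem' replace_row(1) by (metis fun_upd_other image_subsetI)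
  ultimately have "span (a' ` {1..m}) = span (a ` {1..m})"
    by (simp add: span_eq)
  moreover have "lin_map m a l \<bullet> y = Rinner m c l" if "\<forall>i\<in>{1..m}. a i \<bullet> y = c i" for y
    using that by (auto simp: lin_map_def Rinner_def inner_sum_left mult.commute intro!: sum.cong)
  ultimately show ?thesis using replace_row by (auto simp: span_0)
next
  case (switch_rows i j)
  have "a' ` {1..m} = a ` {1..m}" using switch_rows by (auto simp: image_iff)
  then show ?thesis using switch_rows by (auto simp: span_0)
next
  case (shift_rhs u)
  then show ?thesis using lin_map_in_span[of m a u] by simp
qed

lemma reformulation_invariants:
  assumes "reformulation m (a, b, c) (a', b', c')"
  shows "span (a' ` {1..m}) = span (a ` {1..m}) \<and> b' - b \<in> span (a ` {1..m}) \<and>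
    (\<forall>y. (\<forall>i\<in>{1..m}. a i \<bullet> y = c i) \<longrightarrow> (\<forall>i\<in>{1..m}. a' i \<bullet> y = c' i))"
  using assms
proof (induction "(a', b', c')" arbitrary: a' b' c' rule: rtranclp_induct)
  case base
  then show ?case by (simp add: span_0)
next
  case (step s)
  obtain a1 b1 c1 where s: "s = (a1, b1, c1)" by (cases s)
  note 1 = step.hyps(3)[OF s] and 2 = row_op_invariants[OF step.hyps(2)[unfolded s]]
  have "(b1 - b) + (b' - b1) \<in> span (a ` {1..m})" using 1 2 by (intro span_add) simp_all
  with 1 2 show ?case by simp
qed

text \<open>
  One row at a time: the next vector is a combination of the current rows, and independence
  of its predecessors forces a nonzero coefficient at a row \<open>j\<close> not yet in use. That row is replaced
  and moved to its place.
\<close>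

lemma reformulation_with_rows:
  fixes a :: "nat \<Rightarrow> 'a::euclidean_space"
  assumes "\<And>i. i \<in> {1..p} \<Longrightarrow> s i \<in> span (a ` {1..m}) \<and> s i \<notin> span (s ` {1..<i})"
  shows "p \<le> m \<and> (\<exists>a' c'. reformulation m (a, b, c) (a', b, c') \<and> (\<forall>i\<in>{1..p}. a' i = s i))"
  using assms
proof (induction p)
  case 0
  then show ?case by auto
next
  case (Suc p)
  have "s i \<in> span (a ` {1..m}) \<and> s i \<notin> span (s ` {1..<i})" if "i \<in> {1..p}" for i
    using Suc.prems[of i] that by simp
  from Suc.IH[OF this] obtain a' c' where
    a': "p \<le> m" "reformulation m (a, b, c) (a', b, c')" "\<forall>i\<in>{1..p}. a' i = s i" by blast
  have "s (Suc p) \<in> span (a' ` {1..m})"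
    using Suc.prems[of "Suc p"] reformulation_invariants[OF a'(2)] by simp
  then obtain x where x: "x \<in> Rvec m" "lin_map m a' x = s (Suc p)" by (rule span_rows_lin_map)
  have "\<exists>j\<in>{Suc p..m}. x j \<noteq> 0"
  proof (rule ccontr)
    assume none: "\<not> ?thesis"
    have "x i *\<^sub>R a' i \<in> span (s ` {1..<Suc p})" if "i \<in> {1..m}" for i
    proof (cases "i \<le> p")
      case True
      then have "a' i \<in> s ` {1..<Suc p}" using that a'(3) by auto
      then show ?thesis by (intro span_scale span_base)
    next
      case False
      then show ?thesis using that none by (simp add: span_0)
    qed
    then have "s (Suc p) \<in> span (s ` {1..<Suc p})"
      unfolding x(2)[symmetric] lin_map_def by (rule span_sum)
    with Suc.prems[of "Suc p"] show False by simp
  qed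
  then obtain j where j: "Suc p \<le> j" "j \<le> m" "x j \<noteq> 0" by auto
  let ?a1 = "a'(j := s (Suc p))" and ?c1 = "c'(j := Rinner m c' x)"
  have "row_op m (a', b, c') (?a1, b, ?c1)"
    using row_op.replace_row[of j m x a' b c'] j x by simp
  with a'(2) have r1: "reformulation m (a, b, c) (?a1, b, ?c1)" by (rule rtranclp.rtrancl_into_rtrancl)
  show ?case
  proof (cases "j = Suc p")
    case True
    have "\<forall>i\<in>{1..Suc p}. ?a1 i = s i" using a'(3) True by (auto simp: le_Suc_eq)
    with r1 show ?thesis using order_trans[OF j(1,2)] by blast
  next
    case False
    let ?a2 = "?a1(Suc p := ?a1 j, j := ?a1 (Suc p))" and ?c2 = "?c1(Suc p := ?c1 j, j := ?c1 (Suc p))"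
    have "row_op m (?a1, b, ?c1) (?a2, b, ?c2)"
      using j False by (intro row_op.switch_rows) auto
    with r1 have "reformulation m (a, b, c) (?a2, b, ?c2)" by (rule rtranclp.rtrancl_into_rtrancl)
    moreover have "\<forall>i\<in>{1..Suc p}. ?a2 i = s i" using a'(3) False j by (auto simp: le_Suc_eq)
    ultimately show ?thesis using order_trans[OF j(1,2)] by blast
  qed
qed

lemma reformulation_with_rhs:
  assumes r: "reformulation m (a, b, c) (a', b, c')" and d: "d - b \<in> span (a ` {1..m})"
  shows "reformulation m (a, b, c) (a', d, c')"
proof -
  have "d - b \<in> span (a' ` {1..m})" using d reformulation_invariants[OF r] by simp
  then obtain u where u: "u \<in> Rvec m" "lin_map m a' u = d - b" by (rule span_rows_lin_map)
  then have "row_op m (a', b, c') (a', d, c')" using row_op.shift_rhs[of u m a' b c'] by simp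
  with r show ?thesis by (rule rtranclp.rtrancl_into_rtrancl)
qed

section \<open>The four equivalences\<close>

lemma pre_strict_FR_imp_FR: "y \<in> pre_strict_FR k C \<Longrightarrow> y \<in> FR k C"
  by (simp add: pre_strict_FR_def)

text \<open>
  With a solution \<open>y0\<close> of the equations, \<open>(D)\<close> asks for a point of the dual cone in the affine
  space \<open>y0 + L\<^sup>\<bottom>\<close>, where \<open>L\<close> is the span of the rows. The reducing sequence then lies in
  \<open>L\<^sup>\<bottom>\<^sup>\<bottom> = L\<close>. Its terms are independent, the first \<open>k\<close> by strictness and the last
  because \<open>y0\<close> is orthogonal to all of them but the last, so they can be made the first rows.
  Row operations preserve the solution \<open>y0\<close>, so the new right-hand sides are inner products with it.
\<close>

lemma D_infeasible_imp_reformulation: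
  fixes K :: "'a::euclidean_space set"
  assumes inj: "inj_on (lin_map m a) (Rvec m)" and c: "c \<in> Rvec m"
    and infeasible: "\<not> D_feasible m K a c"
  shows "\<exists>k a' b' c'. reformulation m (a, b, c) (a', b', c') \<and>
    k + 1 \<le> m \<and> k \<le> face_chain_length (dual_cone K) - 1 \<and>
    (\<forall>i\<in>{1..k}. c' i = 0) \<and> c' (k + 1) = -1 \<and> a' \<in> pre_strict_FR (k + 1) (dual_cone K)"
proof -
  let ?L = "span (a ` {1..m})"
  obtain y0 where "adj m a y0 = c" by (rule adj_surj[OF inj c])
  then have y0: "\<forall>i\<in>{1..m}. a i \<bullet> y0 = c i" using c by (simp add: adj_eq_iff)
  have "y0 - x \<notin> dual_cone K" if "x \<in> ?L\<^sup>\<bottom>" for x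
  proof -
    have "adj m a (y0 - x) = c"
      using y0 that c by (simp add: adj_eq_iff mem_comp_span_iff inner_diff_right inner_commute)
    then show ?thesis using infeasible by (auto simp: D_feasible_def)
  qed
  from facial_reduction_affine[OF convex_cone_dual_cone subspace_orthogonal_comp this]
  obtain k s where s: "s \<in> pre_strict_FR (k + 1) (dual_cone K)"
    and k: "k \<le> face_chain_length (dual_cone K) - 1"
    and s0: "\<forall>i\<in>{1..k}. s i \<in> ?L\<^sup>\<bottom>\<^sup>\<bottom> \<and> y0 \<bullet> s i = 0"
    and s1: "s (k + 1) \<in> ?L\<^sup>\<bottom>\<^sup>\<bottom>" "y0 \<bullet> s (k + 1) = -1" .
  have LL: "?L\<^sup>\<bottom>\<^sup>\<bottom> = ?L" by (simp add: orthogonal_comp_self)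
  have "s i \<in> ?L \<and> s i \<notin> span (s ` {1..<i})" if i: "i \<in> {1..k + 1}" for i
  proof (cases "i \<le> k")
    case True
    then show ?thesis
      using strict_FR_not_in_span[of s k "dual_cone K" i] s s0 i LL
      by (auto simp: pre_strict_FR_def)
  next
    case False
    then have ik: "i = k + 1" using i by simp
    have "y0 \<in> (span (s ` {1..<k + 1}))\<^sup>\<bottom>" using s0 by (auto simp: mem_comp_span_iff)
    then have "s (k + 1) \<notin> span (s ` {1..<k + 1})" using s1(2) by (auto simp: mem_comp_iff)
    then show ?thesis using s1(1) LL ik by simp
  qed
  from reformulation_with_rows[OF this, where b = b and c = c]
  obtain a' c' where a': "k + 1 \<le> m" "reformulation m (a, b, c) (a', b, c')"
    "\<forall>i\<in>{1..k + 1}. a' i = s i" by blast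
  then have "\<forall>i\<in>{1..m}. a' i \<bullet> y0 = c' i" using reformulation_invariants y0 by blast
  then have c': "c' i = y0 \<bullet> s i" if "i \<in> {1..k + 1}" for i
    using that a'(1,3) by (metis atLeastAtMost_iff inner_commute order_trans)
  have "a' \<in> pre_strict_FR (k + 1) (dual_cone K)"
    using pre_strict_FR_cong[of "k + 1" a' s] s a'(3) by blast
  moreover have "\<forall>i\<in>{1..k}. c' i = 0" using c' s0 by simp
  moreover have "c' (k + 1) = -1" using c'[of "k + 1"] s1 by simp
  ultimately show ?thesis using a' k by blast
qed

lemma reformulation_imp_D_infeasible:
  fixes K :: "'a::euclidean_space set"
  assumes c: "c \<in> Rvec m" and r: "reformulation m (a, b, c) (a', b', c')" and "k + 1 \<le> m"
    and "\<forall>i\<in>{1..k}. c' i = 0" "c' (k + 1) = -1" and FR: "a' \<in> FR (k + 1) (dual_cone K)"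
  shows "\<not> D_feasible m K a c"
proof
  assume "D_feasible m K a c"
  then obtain y where y: "y \<in> dual_cone K" "\<forall>i\<in>{1..m}. a i \<bullet> y = c i"
    using c by (auto simp: D_feasible_def adj_eq_iff)
  then have "\<forall>i\<in>{1..m}. a' i \<bullet> y = c' i" using reformulation_invariants[OF r] by blast
  then have "a' (k + 1) \<bullet> y = -1" "\<And>i. i \<in> {1..k} \<Longrightarrow> y \<bullet> a' i = 0"
    using assms(3-5) by (auto simp: inner_commute)
  with FR_last_nonneg[OF FR y(1)] show False by force
qed

text \<open>
  Not being strongly infeasible says, after scaling, that \<open>c\<close> is nonnegative on the points of
  \<open>K\<close> in the range of \<open>A\<close>; there \<open>c\<close> acts as the inner product with any \<open>z\<close> such that
  \<open>A\<^sup>* z = c\<close>.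
\<close>

lemma D_not_strongly_infeasible_imp_FR:
  fixes K :: "'a::euclidean_space set"
  assumes K: "convex_cone K" and inj: "inj_on (lin_map m a) (Rvec m)" and c: "c \<in> Rvec m"
    and nsi: "\<not> D_strongly_infeasible m K a c"
  shows "\<exists>l y. y \<in> pre_strict_FR (l + 1) K \<and> l \<le> face_chain_length K - 1 \<and>
    (\<forall>i\<in>{1..l}. adj m a (y i) = (\<lambda>_. 0)) \<and> adj m a (y (l + 1)) = c"
proof -
  let ?L = "span (a ` {1..m})"
  obtain z where z: "adj m a z = c" by (rule adj_surj[OF inj c])
  have "0 \<le> z \<bullet> v" if v: "v \<in> K" "v \<in> ?L" for v
  proof (rule ccontr)
    assume neg: "\<not> 0 \<le> z \<bullet> v"
    define w where "w = (- 1 / (z \<bullet> v)) *\<^sub>R v"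
    have "w \<in> K" unfolding w_def
      by (rule convex_cone_scaleR[OF K _ v(1)]) (use neg in \<open>simp add: divide_nonpos_neg\<close>)
    have "w \<in> ?L" unfolding w_def by (rule span_scale[OF v(2)])
    then obtain x where x: "x \<in> Rvec m" "lin_map m a x = w" by (rule span_rows_lin_map)
    have "Rinner m c x = w \<bullet> z" using Rinner_adj[of m a z x] z x by simp
    also have "\<dots> = -1" using neg by (simp add: w_def inner_commute)
    finally show False using nsi x \<open>w \<in> K\<close> by (auto simp: D_strongly_infeasible_def)
  qed
  from facial_reduction_subspace[OF K subspace_span this] obtain l y where
    ly: "y \<in> pre_strict_FR (l + 1) K" "l \<le> face_chain_length K - 1"
      "\<forall>i\<in>{1..l}. y i \<in> ?L\<^sup>\<bottom>" "y (l + 1) - z \<in> ?L\<^sup>\<bottom>" .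
  have "adj m a (y (l + 1)) = c"
    using ly(4) z c
    by (simp add: adj_eq_iff mem_comp_span_iff inner_diff_left inner_diff_right inner_commute)
  with ly show ?thesis by (auto simp: adj_eq_0_iff)
qed

lemma FR_imp_D_not_strongly_infeasible:
  fixes K :: "'a::euclidean_space set"
  assumes FR: "y \<in> FR (l + 1) K" and "\<forall>i\<in>{1..l}. adj m a (y i) = (\<lambda>_. 0)"
    and "adj m a (y (l + 1)) = c"
  shows "\<not> D_strongly_infeasible m K a c"
proof
  assume "D_strongly_infeasible m K a c"
  then obtain x where x: "lin_map m a x \<in> K" "Rinner m c x = -1"
    by (auto simp: D_strongly_infeasible_def)
  have "lin_map m a x \<bullet> y i = 0" if "i \<in> {1..l}" for i
    using Rinner_adj[of m a "y i" x] assms(2) that by (simp add: Rinner_def)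
  with FR_last_nonneg[OF FR x(1)] have "0 \<le> y (l + 1) \<bullet> lin_map m a x" .
  with Rinner_adj[of m a "y (l + 1)" x] x assms(3) show False by (simp add: inner_commute)
qed

text \<open>Here the affine space is \<open>b\<close> plus the range of \<open>A\<close>.\<close>

lemma P_infeasible_imp_FR:
  fixes K :: "'a::euclidean_space set"
  assumes K: "convex_cone K" and infeasible: "\<not> P_feasible m K a b"
  shows "\<exists>k y. y \<in> pre_strict_FR (k + 1) K \<and> k \<le> face_chain_length K - 1 \<and>
    (\<forall>i\<in>{1..k}. adj m a (y i) = (\<lambda>_. 0) \<and> b \<bullet> y i = 0) \<and>
    adj m a (y (k + 1)) = (\<lambda>_. 0) \<and> b \<bullet> y (k + 1) = -1"
proof -
  have "b - v \<notin> K" if v: "v \<in> span (a ` {1..m})" for v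
  proof -
    obtain x where "x \<in> Rvec m" "lin_map m a x = v" by (rule span_rows_lin_map[OF v])
    then show ?thesis using infeasible by (auto simp: P_feasible_def cone_le_def)
  qed
  from facial_reduction_affine[OF K subspace_span this] show ?thesis
    unfolding adj_eq_0_iff by metis
qed

lemma FR_imp_P_infeasible:
  fixes K :: "'a::euclidean_space set"
  assumes FR: "y \<in> FR (k + 1) K"
    and "\<forall>i\<in>{1..k}. adj m a (y i) = (\<lambda>_. 0) \<and> b \<bullet> y i = 0"
    and "adj m a (y (k + 1)) = (\<lambda>_. 0)" "b \<bullet> y (k + 1) = -1"
  shows "\<not> P_feasible m K a b"
proof
  assume "P_feasible m K a b"
  then obtain x where x: "b - lin_map m a x \<in> K" by (auto simp: P_feasible_def cone_le_def)
  have "lin_map m a x \<bullet> y i = 0" if "adj m a (y i) = (\<lambda>_. 0)" for i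
    using Rinner_adj[of m a "y i" x] that by (simp add: Rinner_def)
  then have "(b - lin_map m a x) \<bullet> y i = b \<bullet> y i" if "i \<in> {1..k + 1}" for i
    using that assms(2,3) by (cases "i = k + 1") (auto simp: inner_diff_left)
  with FR_last_nonneg[OF FR x] assms(2,4) show False by (simp add: inner_commute)
qed

text \<open>
  The roles of the range of \<open>A\<close> and its orthogonal complement are exchanged, and \<open>b\<close> is the
  functional nonnegative on the dual cone there. The last term agrees with \<open>b\<close> modulo the
  range of \<open>A\<close>, so a shift of the right-hand side produces it, and only the earlier ones need
  to be rows.
\<close>

lemma P_not_strongly_infeasible_imp_reformulation:
  fixes K :: "'a::euclidean_space set"
  assumes nsi: "\<not> P_strongly_infeasible m K a b"
  shows "\<exists>l a' b' c'. reformulation m (a, b, c) (a', b', c') \<and>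
    l \<le> min m (face_chain_length (dual_cone K) - 1) \<and>
    a'(l + 1 := b') \<in> pre_strict_FR (l + 1) (dual_cone K)"
proof -
  let ?L = "span (a ` {1..m})"
  have "0 \<le> b \<bullet> y" if y: "y \<in> dual_cone K" "y \<in> ?L\<^sup>\<bottom>" for y
  proof (rule ccontr)
    assume neg: "\<not> 0 \<le> b \<bullet> y"
    define w where "w = (- 1 / (b \<bullet> y)) *\<^sub>R y"
    have "w \<in> dual_cone K" unfolding w_def
      by (rule convex_cone_scaleR[OF convex_cone_dual_cone _ y(1)])
        (use neg in \<open>simp add: divide_nonpos_neg\<close>)
    moreover have "w \<in> ?L\<^sup>\<bottom>"
      unfolding w_def by (intro subspace_scale subspace_orthogonal_comp y)
    moreover have "b \<bullet> w = -1" using neg by (simp add: w_def)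
    ultimately show False using nsi by (auto simp: P_strongly_infeasible_def adj_eq_0_iff)
  qed
  from facial_reduction_subspace[OF convex_cone_dual_cone subspace_orthogonal_comp this]
  obtain l s where s: "s \<in> pre_strict_FR (l + 1) (dual_cone K)"
    and l: "l \<le> face_chain_length (dual_cone K) - 1"
    and s0: "\<forall>i\<in>{1..l}. s i \<in> ?L\<^sup>\<bottom>\<^sup>\<bottom>" and s1: "s (l + 1) - b \<in> ?L\<^sup>\<bottom>\<^sup>\<bottom>" .
  have LL: "?L\<^sup>\<bottom>\<^sup>\<bottom> = ?L" by (simp add: orthogonal_comp_self)
  have "s i \<in> ?L \<and> s i \<notin> span (s ` {1..<i})" if "i \<in> {1..l}" for i
    using strict_FR_not_in_span[OF _ that, of s "dual_cone K"] s bspec[OF s0 that] LL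
    by (simp add: pre_strict_FR_def)
  from reformulation_with_rows[OF this, where b = b and c = c]
  obtain a' c' where a': "l \<le> m" "reformulation m (a, b, c) (a', b, c')"
    "\<forall>i\<in>{1..l}. a' i = s i" by blast
  have "reformulation m (a, b, c) (a', s (l + 1), c')"
    by (rule reformulation_with_rhs[OF a'(2)]) (use s1 LL in simp)
  moreover have "a'(l + 1 := s (l + 1)) \<in> pre_strict_FR (l + 1) (dual_cone K)"
    using pre_strict_FR_cong[of "l + 1" "a'(l + 1 := s (l + 1))" s] s a'(3) by auto
  ultimately show ?thesis using a'(1) l by (metis min.boundedI)
qed

lemma reformulation_imp_P_not_strongly_infeasible:
  fixes K :: "'a::euclidean_space set"
  assumes r: "reformulation m (a, b, c) (a', b', c')" and l: "l \<le> m"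
    and FR: "a'(l + 1 := b') \<in> FR (l + 1) (dual_cone K)"
  shows "\<not> P_strongly_infeasible m K a b"
proof
  let ?L = "span (a ` {1..m})"
  assume "P_strongly_infeasible m K a b"
  then obtain y where y: "y \<in> dual_cone K" "y \<in> ?L\<^sup>\<bottom>" "b \<bullet> y = -1"
    by (auto simp: P_strongly_infeasible_def adj_eq_0_iff)
  have inv: "span (a' ` {1..m}) = ?L" "b' - b \<in> ?L" using reformulation_invariants[OF r] by auto
  have "y \<bullet> (a'(l + 1 := b')) i = 0" if "i \<in> {1..l}" for i
  proof -
    have "a' i \<in> ?L" using that l unfolding inv(1)[symmetric] by (intro span_base) auto
    then show ?thesis using y(2) that by (simp add: mem_comp_iff)
  qed
  from FR_last_nonneg[OF FR y(1) this] have "0 \<le> b' \<bullet> y" by simp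
  moreover have "y \<bullet> (b' - b) = 0" using y(2) inv(2) by (simp only: mem_comp_iff)
  ultimately show False using y(3) by (simp add: inner_diff_right inner_commute)
qed

theorem theorem4:
  fixes K :: "'a::euclidean_space set" and m :: nat
    and a :: "nat \<Rightarrow> 'a" and b :: 'a and c :: "nat \<Rightarrow> real"
  assumes "closed K" and "convex_cone K"
    and "inj_on (lin_map m a) (Rvec m)"
    and "c \<in> Rvec m"
  shows
    "((\<not> D_feasible m K a c \<longleftrightarrow>
        (\<exists>k a' b' c'. reformulation m (a, b, c) (a', b', c') \<and>
           k + 1 \<le> m \<and> k \<le> face_chain_length (dual_cone K) - 1 \<and>
           (\<forall>i\<in>{1..k}. c' i = 0) \<and> c' (k + 1) = -1 \<and>
           a' \<in> FR (k + 1) (dual_cone K)))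
     \<and> (\<not> D_feasible m K a c \<longrightarrow>
        (\<exists>k a' b' c'. reformulation m (a, b, c) (a', b', c') \<and>
           k + 1 \<le> m \<and> k \<le> face_chain_length (dual_cone K) - 1 \<and>
           (\<forall>i\<in>{1..k}. c' i = 0) \<and> c' (k + 1) = -1 \<and>
           a' \<in> pre_strict_FR (k + 1) (dual_cone K))))

   \<and> ((\<not> D_strongly_infeasible m K a c \<longleftrightarrow>
        (\<exists>l y. y \<in> FR (l + 1) K \<and> l \<le> face_chain_length K - 1 \<and>
           (\<forall>i\<in>{1..l}. adj m a (y i) = (\<lambda>_. 0)) \<and> adj m a (y (l + 1)) = c))
     \<and> (\<not> D_strongly_infeasible m K a c \<longrightarrow>
        (\<exists>l y. y \<in> pre_strict_FR (l + 1) K \<and> l \<le> face_chain_length K - 1 \<and>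
           (\<forall>i\<in>{1..l}. adj m a (y i) = (\<lambda>_. 0)) \<and> adj m a (y (l + 1)) = c)))

   \<and> ((\<not> P_feasible m K a b \<longleftrightarrow>
        (\<exists>k y. y \<in> FR (k + 1) K \<and> k \<le> face_chain_length K - 1 \<and>
           (\<forall>i\<in>{1..k}. adj m a (y i) = (\<lambda>_. 0) \<and> b \<bullet> y i = 0) \<and>
           adj m a (y (k + 1)) = (\<lambda>_. 0) \<and> b \<bullet> y (k + 1) = -1))
     \<and> (\<not> P_feasible m K a b \<longrightarrow>
        (\<exists>k y. y \<in> pre_strict_FR (k + 1) K \<and> k \<le> face_chain_length K - 1 \<and>
           (\<forall>i\<in>{1..k}. adj m a (y i) = (\<lambda>_. 0) \<and> b \<bullet> y i = 0) \<and>
           adj m a (y (k + 1)) = (\<lambda>_. 0) \<and> b \<bullet> y (k + 1) = -1)))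

   \<and> ((\<not> P_strongly_infeasible m K a b \<longleftrightarrow>
        (\<exists>l a' b' c'. reformulation m (a, b, c) (a', b', c') \<and>
           l \<le> min m (face_chain_length (dual_cone K) - 1) \<and>
           a'(l + 1 := b') \<in> FR (l + 1) (dual_cone K)))
     \<and> (\<not> P_strongly_infeasible m K a b \<longrightarrow>
        (\<exists>l a' b' c'. reformulation m (a, b, c) (a', b', c') \<and>
           l \<le> min m (face_chain_length (dual_cone K) - 1) \<and>
           a'(l + 1 := b') \<in> pre_strict_FR (l + 1) (dual_cone K))))"
proof -
  note P1 = D_infeasible_imp_reformulation[OF assms(3,4)]
    and P2 = D_not_strongly_infeasible_imp_FR[OF assms(2-4)]
    and P3 = P_infeasible_imp_FR[OF assms(2)]
    and P4 = P_not_strongly_infeasible_imp_reformulation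
  show ?thesis
  proof (intro conjI impI iffI)
    show "\<not> D_feasible m K a c" if "\<exists>k a' b' c'. reformulation m (a, b, c) (a', b', c') \<and>
           k + 1 \<le> m \<and> k \<le> face_chain_length (dual_cone K) - 1 \<and>
           (\<forall>i\<in>{1..k}. c' i = 0) \<and> c' (k + 1) = -1 \<and> a' \<in> FR (k + 1) (dual_cone K)"
      using that reformulation_imp_D_infeasible[OF assms(4)] by blast
    show "\<not> D_strongly_infeasible m K a c"
      if "\<exists>l y. y \<in> FR (l + 1) K \<and> l \<le> face_chain_length K - 1 \<and>
           (\<forall>i\<in>{1..l}. adj m a (y i) = (\<lambda>_. 0)) \<and> adj m a (y (l + 1)) = c"
      using that FR_imp_D_not_strongly_infeasible by blast
    show "\<not> P_feasible m K a b"
      if "\<exists>k y. y \<in> FR (k + 1) K \<and> k \<le> face_chain_length K - 1 \<and>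
           (\<forall>i\<in>{1..k}. adj m a (y i) = (\<lambda>_. 0) \<and> b \<bullet> y i = 0) \<and>
           adj m a (y (k + 1)) = (\<lambda>_. 0) \<and> b \<bullet> y (k + 1) = -1"
      using that FR_imp_P_infeasible by blast
    show "\<not> P_strongly_infeasible m K a b"
      if "\<exists>l a' b' c'. reformulation m (a, b, c) (a', b', c') \<and>
           l \<le> min m (face_chain_length (dual_cone K) - 1) \<and>
           a'(l + 1 := b') \<in> FR (l + 1) (dual_cone K)"
      using that reformulation_imp_P_not_strongly_infeasible by (metis min.boundedE)
  qed (use P1 P2 P3 P4 pre_strict_FR_imp_FR in meson)+
qed

end
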